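(* Let $n \geq 12$ and $d \geq 2$ be integers and let $\delta \in (e^{-n/6}, e^{-2})$. Define the estimator $\widehat P_{n,\delta} = (\widehat p_1,\dots,\widehat p_d)$ by, for $j=1,\dots,d$, $$\widehat p_j = \frac{N_j + \lambda_\delta}{n + \lambda_\delta d}, \qquad \text{where} \qquad \lambda_\delta = \max\Big\{ 1, \frac{\log(1/\delta)}{d} \Big\} .$$ Then, for any $P \in \mathcal{P}_d$, $$\mathbb{P}_P\bigg( \mathrm{KL}(P,\widehat P_{n,\delta}) \geq 110000\, \frac{d + \log(d)\log(1/\delta)}{n} \bigg) \leq 4\delta .$$
   Context: $\mathcal{P}_d$ is the set of probability vectors $P=(p_1,\dots,p_d)$ (with $p_j\ge 0$, $\sum_j p_j=1$), identified with probability distributions on $\{1,\dots,d\}$. $X_1,\dots,X_n$ are i.i.d. with distribution $P$, $\mathbb{P}_P$ is probability under this law, and $N_j=\sum_{i=1}^n \mathbf{1}(X_i=j)$. For $P,Q\in\mathcal{P}_d$, $\mathrm{KL}(P,Q)=\sum_{j=1}^d p_j\log(p_j/q_j)\in[0,+\infty]$, with the convention that a term is $0$ if $p_j=0$ and $+\infty$ if $p_j>0=q_j$. $\log$ is the natural logarithm. *)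

theory Defs
  imports "HOL-Probability.Probability"
begin

text \<open>
  A vector indexed by \<open>{1..d}\<close> is a function \<open>nat \<Rightarrow> real\<close>; only its values on \<open>{1..d}\<close> are ever used.
\<close>

definition prob_vectors :: "nat \<Rightarrow> (nat \<Rightarrow> real) set" where
  "prob_vectors d = {p. (\<forall>j\<in>{1..d}. 0 \<le> p j) \<and> (\<Sum>j\<in>{1..d}. p j) = 1}"

text \<open>
  The library constant \<open>KL_divergence\<close> is real-valued, so it cannot express
  the value \<open>\<infinity>\<close> taken when absolute continuity fails.
\<close>

definition kl_term :: "real \<Rightarrow> real \<Rightarrow> ereal" where
  "kl_term p q = (if p = 0 then 0 else if q = 0 then \<infinity> else ereal (p * ln (p / q)))"

definition KL :: "nat \<Rightarrow> (nat \<Rightarrow> real) \<Rightarrow> (nat \<Rightarrow> real) \<Rightarrow> ereal" where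
  "KL d p q = (\<Sum>j\<in>{1..d}. kl_term (p j) (q j))"

definition occurrences :: "nat \<Rightarrow> (nat \<Rightarrow> nat) \<Rightarrow> nat \<Rightarrow> nat" where
  "occurrences n x j = (\<Sum>i\<in>{1..n}. of_bool (x i = j))"

definition smoothing :: "nat \<Rightarrow> real \<Rightarrow> real" where
  "smoothing d \<delta> = max 1 (ln (1 / \<delta>) / real d)"

definition estimator :: "nat \<Rightarrow> nat \<Rightarrow> real \<Rightarrow> (nat \<Rightarrow> nat) \<Rightarrow> nat \<Rightarrow> real" where
  "estimator n d \<delta> x j =
     (real (occurrences n x j) + smoothing d \<delta>) / (real n + smoothing d \<delta> * real d)"

text \<open>
  \<open>X 1, \<dots>, X n\<close> are independent \<open>{1..d}\<close>-valued random variables on \<open>M\<close>, each with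
  probability mass function \<open>p\<close> (a density with respect to counting measure).
\<close>

definition iid_sample ::
  "'w measure \<Rightarrow> nat \<Rightarrow> nat \<Rightarrow> (nat \<Rightarrow> real) \<Rightarrow> (nat \<Rightarrow> 'w \<Rightarrow> nat) \<Rightarrow> bool" where
  "iid_sample M n d p X \<longleftrightarrow>
     prob_space M \<and>
     prob_space.indep_vars M (\<lambda>_. count_space {1..d}) X {1..n} \<and>
     (\<forall>i\<in>{1..n}. distributed M (count_space {1..d}) (X i) (\<lambda>j. ennreal (p j)))"

end

theory Submission
  imports Defs
begin

text \<open>
  Write \<open>\<mu> j = n * p j\<close>, \<open>L = ln (1 / \<delta>)\<close>, and \<open>l\<close> for the smoothing parameter. Up to a normalization
  that only helps, \<open>n * KL\<close> is the sum over \<open>j\<close> of \<open>D(\<mu> j, N j + l)\<close>, where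
  \<open>D(a, b) = a * ln (a / b) - a + b\<close>. If \<open>N j + l \<ge> \<mu> j / 4\<close>, the term is of the order of the squared
  Hellinger term \<open>(sqrt (N j) - sqrt (\<mu> j))\<^sup>2\<close> plus \<open>l\<close>; otherwise it is at most \<open>\<mu> j * ln (\<mu> j / l)\<close>.
  Letters with \<open>\<mu> j \<ge> 3 * (L + ln d)\<close> never fall in the second case, by a union bound, and for the
  others \<open>ln (\<mu> j / l)\<close> is at most \<open>4 * ln d\<close>, so that the sum of these terms has an exponential
  moment of order \<open>1 / ln d\<close>.

  All moments are computed without independence of the counts: since \<open>1 + x \<le> exp x\<close>, the
  expectation of the product of \<open>y j ^ N j\<close> is at most that for independent Poisson counts with means
  \<open>\<mu> j\<close>, for every \<open>y \<ge> 0\<close>. This extends to products of positive mixtures of such powers, and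
  mixtures dominating the exponentials of both statistics are written down explicitly.
\<close>

section \<open>Scalar comparison of relative entropy with Hellinger terms\<close>

text \<open>Bounding \<open>ln (a / b)\<close> by \<open>a / b - 1\<close> leaves the chi-square
  term \<open>(b - a)^2 / b\<close>. Its numerator factors through square roots, and
  \<open>a <= 4 * b\<close> bounds the second squared factor by \<open>9 * b\<close>.\<close>

lemma relative_entropy_le_hellinger:
  fixes a b :: real
  assumes "0 \<le> a" "0 < b" "a / 4 \<le> b"
  shows "a * ln (a / b) - a + b \<le> 9 * (sqrt b - sqrt a)\<^sup>2"
proof -
  have "a * ln (a / b) \<le> a * (a / b - 1)"
    using assms by (cases "a = 0") (auto intro!: mult_left_mono ln_le_minus_one)
  then have "a * ln (a / b) - a + b \<le> (b - a)\<^sup>2 / b"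
    using assms by (simp add: field_simps power2_eq_square)
  also have "(b - a)\<^sup>2 = (sqrt b - sqrt a)\<^sup>2 * (sqrt b + sqrt a)\<^sup>2"
    using assms by (simp add: power_mult_distrib[symmetric] algebra_simps)
  also have "\<dots> / b \<le> (sqrt b - sqrt a)\<^sup>2 * (9 * b) / b"
  proof -
    have "sqrt a \<le> sqrt (4 * b)" using assms by (intro real_sqrt_le_mono) simp
    then have "sqrt b + sqrt a \<le> 3 * sqrt b" by (simp add: real_sqrt_mult)
    then have "(sqrt b + sqrt a)\<^sup>2 \<le> (3 * sqrt b)\<^sup>2" using assms by (intro power_mono) auto
    also have "\<dots> = 9 * b" using assms by (simp add: power_mult_distrib)
    finally show ?thesis using assms by (intro divide_right_mono mult_left_mono) auto
  qed
  finally show ?thesis using assms by simp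
qed

text \<open>Takes the smoothing parameter out of the Hellinger term:
  \<open>sqrt (x + l) - sqrt x\<close> is at most \<open>sqrt l\<close>, and
  \<open>(u + v)^2 <= 2 * u^2 + 2 * v^2\<close>.\<close>

lemma sqrt_shift_diff_le:
  fixes x a l :: real
  assumes "0 \<le> x" "0 \<le> l"
  shows "(sqrt (x + l) - sqrt a)\<^sup>2 \<le> 2 * (sqrt x - sqrt a)\<^sup>2 + 2 * l"
proof -
  define u v where "u = sqrt (x + l) - sqrt x" and "v = sqrt x - sqrt a"
  have "0 \<le> u" "u \<le> sqrt l"
    using assms sqrt_add_le_add_sqrt[of x l] by (auto simp: u_def)
  then have "u\<^sup>2 \<le> l" using power_mono[of u "sqrt l" 2] assms by simp
  moreover have "(u + v)\<^sup>2 \<le> 2 * v\<^sup>2 + 2 * u\<^sup>2"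
    using zero_le_power2[of "u - v"] by (simp add: power2_eq_square algebra_simps)
  ultimately show ?thesis by (simp add: u_def v_def)
qed

section \<open>Gaussian mixtures of Poisson tilts\<close>

text \<open>Since \<open>k <= k^2\<close>, each half is dominated by a geometric series of ratio at
  most \<open>2 / 3\<close>, whatever \<open>m\<close> is. Both halves together give 6, which is
  below \<open>25 / 4 <= exp 2\<close>.\<close>

lemma sum_gaussian_weights_le: "(\<Sum>k\<in>{- int m..int m}. exp (- (real_of_int k)\<^sup>2 / 2)) \<le> exp 2"
proof -
  let ?q = "exp (- 1 / 2 :: real)"
  have q: "0 < ?q" "?q \<le> 2 / 3"
  proof -
    have "3 / 2 \<le> exp (1 / 2 :: real)" using exp_ge_add_one_self[of "1/2 :: real"] by simp
    then show "?q \<le> 2 / 3" by (simp add: exp_minus field_simps)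
  qed simp
  have half: "(\<Sum>k\<le>m. exp (- (real k)\<^sup>2 / 2)) \<le> 3"
  proof -
    have "(\<Sum>k\<le>m. exp (- (real k)\<^sup>2 / 2)) \<le> (\<Sum>k\<le>m. ?q ^ k)"
    proof (rule sum_mono)
      fix k
      have "real k \<le> (real k)\<^sup>2" by (cases k) (auto simp: power2_eq_square)
      then show "exp (- (real k)\<^sup>2 / 2) \<le> ?q ^ k"
        by (simp add: exp_of_nat_mult[symmetric])
    qed
    also have "\<dots> = (1 - ?q ^ Suc m) / (1 - ?q)"
      using q by (subst sum_gp0) auto
    also have "\<dots> \<le> 1 / (1 / 3)" using q by (intro frac_le) auto
    finally show ?thesis by simp
  qed
  \<comment> \<open>Zero lies in both images; counting it twice only enlarges the bound.\<close>
  have "{- int m..int m} \<subseteq> int ` {..m} \<union> (\<lambda>k. - int k) ` {..m}"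
  proof
    fix k assume "k \<in> {- int m..int m}"
    then show "k \<in> int ` {..m} \<union> (\<lambda>k. - int k) ` {..m}"
      by (cases "0 \<le> k") (auto intro: image_eqI[of _ _ "nat k"] image_eqI[of _ _ "nat (- k)"])
  qed
  then have "(\<Sum>k\<in>{- int m..int m}. exp (- (real_of_int k)\<^sup>2 / 2))
      \<le> (\<Sum>k\<in>int ` {..m} \<union> (\<lambda>k. - int k) ` {..m}. exp (- (real_of_int k)\<^sup>2 / 2))"
    by (intro sum_mono2) auto
  also have "\<dots> \<le> (\<Sum>k\<in>int ` {..m}. exp (- (real_of_int k)\<^sup>2 / 2))
      + (\<Sum>k\<in>(\<lambda>k. - int k) ` {..m}. exp (- (real_of_int k)\<^sup>2 / 2))"
    by (subst sum.union_inter[symmetric]) (auto intro!: sum_nonneg)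
  also have "\<dots> = 2 * (\<Sum>k\<le>m. exp (- (real k)\<^sup>2 / 2))"
    by (subst (1 2) sum.reindex) (auto simp: inj_on_def)
  also have "\<dots> \<le> 6" using half by simp
  also have "\<dots> \<le> exp (2 :: real)"
  proof -
    have "(5 / 2 :: real) \<le> exp 1" using exp_lower_Taylor_quadratic[of "1::real"] by simp
    then have "(5 / 2)\<^sup>2 \<le> (exp 1 :: real)\<^sup>2" by (intro power_mono) auto
    moreover have "(exp 1)\<^sup>2 = exp (2 :: real)" using exp_double[of "1::real"] by simp
    moreover have "(5 / 2 :: real)\<^sup>2 = 25 / 4" by (simp add: power_divide)
    ultimately show ?thesis by linarith
  qed
  finally show ?thesis .
qed

text \<open>At \<open>m = 0\<close> the quotient would be 0 by convention and its powers would
  vanish at positive counts; \<open>exp 1\<close> keeps the pointwise mixture bound true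
  there.\<close>

definition tilt :: "real \<Rightarrow> int \<Rightarrow> real" where
  "tilt m k = (if m = 0 then exp 1 else (sqrt m + of_int k)\<^sup>2 / m)"

lemma tilt_nonneg: "0 \<le> m \<Longrightarrow> 0 \<le> tilt m k"
  by (simp add: tilt_def)

text \<open>With \<open>r = sqrt m + k\<close>, the right-hand side is the likelihood ratio at
  \<open>N\<close> of the Poisson laws with means \<open>r^2\<close> and \<open>m\<close>. At
  \<open>N = r^2\<close> it is at least \<open>exp (k^2)\<close>, and moving \<open>N\<close> past
  \<open>r^2\<close> in the direction of \<open>k\<close> cannot decrease it.\<close>

lemma tilt_power_ge:
  fixes m :: real and N :: nat and k :: int
  assumes "0 < m" and r: "0 \<le> sqrt m + of_int k"
    and up: "0 < k \<Longrightarrow> (sqrt m + of_int k)\<^sup>2 \<le> real N"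
    and down: "k < 0 \<Longrightarrow> real N \<le> (sqrt m + of_int k)\<^sup>2"
  shows "exp ((of_int k)\<^sup>2) \<le> exp (- (m * (tilt m k - 1))) * tilt m k ^ N"
proof -
  define r where "r = sqrt m + of_int k"
  have tilt: "tilt m k = r\<^sup>2 / m" using assms by (simp add: tilt_def r_def)
  have e: "- (m * (tilt m k - 1)) = m - r\<^sup>2" using assms by (simp add: tilt field_simps)
  show ?thesis
  proof (cases "r = 0")
    \<comment> \<open>Here \<open>ln y\<close> is of no use, as \<open>y = 0\<close>; but
      \<open>N = 0\<close> is forced and the power is \<open>0 ^ 0 = 1\<close>.\<close>
    case True
    then have "(of_int k)\<^sup>2 = m"
      using \<open>0 < m\<close> by (simp add: r_def add_eq_0_iff)
    moreover have "k < 0" using True \<open>0 < m\<close> r_def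
      by (metis add_pos_nonneg not_less of_int_0_le_iff less_irrefl real_sqrt_gt_zero)
    then have "N = 0" using down True by (simp add: r_def)
    ultimately show ?thesis using True e by simp
  next
    case False
    then have "0 < r" using r by (simp add: r_def)
    define y where "y = r\<^sup>2 / m"
    have "0 < y" using \<open>0 < r\<close> \<open>0 < m\<close> by (simp add: y_def)
    have "0 < sqrt m" using \<open>0 < m\<close> by simp
    have ln_y: "ln y = 2 * ln (r / sqrt m)"
    proof -
      have "y = (r / sqrt m)\<^sup>2" using \<open>0 < m\<close> by (simp add: y_def power_divide)
      then show ?thesis using \<open>0 < r\<close> \<open>0 < m\<close> by (simp add: ln_realpow)
    qed
    \<comment> \<open>\<open>ln y\<close> has the sign of \<open>k\<close>, so \<open>up\<close> and
      \<open>down\<close> each apply where they are needed.\<close>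
    have "r\<^sup>2 * ln y \<le> real N * ln y"
    proof (cases k "0 :: int" rule: linorder_cases)
      case greater
      then have "1 \<le> r / sqrt m" using \<open>0 < sqrt m\<close> by (simp add: r_def)
      then have "0 \<le> ln y" by (simp add: ln_y)
      then show ?thesis using up greater by (intro mult_right_mono) (auto simp: r_def)
    next
      case equal
      then have "ln y = 0" using \<open>0 < sqrt m\<close> by (simp add: ln_y r_def)
      then show ?thesis by simp
    next
      case less
      then have "r / sqrt m \<le> 1" using \<open>0 < sqrt m\<close> by (simp add: r_def)
      then have "ln y \<le> 0" using \<open>0 < r\<close> \<open>0 < sqrt m\<close> by (simp add: ln_y)
      then show ?thesis using down less by (intro mult_right_mono_neg) (auto simp: r_def)
    qed
    \<comment> \<open>Relative entropy dominates the squared Hellinger term: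
      \<open>ln x <= x - 1\<close> at the ratio of square roots.\<close>
    moreover have "(of_int k)\<^sup>2 \<le> r\<^sup>2 * ln y - r\<^sup>2 + m"
    proof -
      have "ln (sqrt m / r) \<le> sqrt m / r - 1"
        using \<open>0 < r\<close> \<open>0 < sqrt m\<close> by (intro ln_le_minus_one) simp
      then have "1 - sqrt m / r \<le> ln (r / sqrt m)"
        using \<open>0 < r\<close> \<open>0 < sqrt m\<close> by (simp add: ln_div)
      then have "r\<^sup>2 * (2 * (1 - sqrt m / r)) \<le> r\<^sup>2 * ln y"
        unfolding ln_y by (intro mult_left_mono) auto
      moreover have "r\<^sup>2 * (2 * (1 - sqrt m / r)) = 2 * r\<^sup>2 - 2 * r * sqrt m"
        using \<open>0 < r\<close> by (simp add: field_simps power2_eq_square)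
      moreover have "(of_int k)\<^sup>2 = (r - sqrt m)\<^sup>2" by (simp add: r_def)
      moreover have "(r - sqrt m)\<^sup>2 = r\<^sup>2 - 2 * r * sqrt m + m"
        using \<open>0 < m\<close> by (simp add: power2_diff)
      ultimately show ?thesis by simp
    qed
    ultimately have "(of_int k)\<^sup>2 \<le> (m - r\<^sup>2) + real N * ln y" by simp
    then have "exp ((of_int k)\<^sup>2) \<le> exp ((m - r\<^sup>2) + real N * ln y)" by simp
    also have "\<dots> = exp (m - r\<^sup>2) * y ^ N"
      using \<open>0 < y\<close> by (simp add: exp_add exp_of_nat_mult)
    finally show ?thesis unfolding e unfolding tilt y_def .
  qed
qed

text \<open>
  The tilt \<^term>\<open>tilt m k\<close> recentres a Poisson variable of mean \<open>m\<close> at \<open>(sqrt m + k)\<^sup>2\<close>. One of these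
  centres lies within distance \<open>1\<close> of \<open>N\<close> on the square-root scale, and the Gaussian prior
  weight costs only half of the exponent gained there.
\<close>

lemma exp_hellinger_le_mixture:
  fixes m :: real and N n :: nat
  assumes "0 \<le> m" "m \<le> real n" "N \<le> n"
  shows "exp ((sqrt (real N) - sqrt m)\<^sup>2 / 4 - 1 / 2)
    \<le> (\<Sum>k\<in>{- int n..int n}. exp (- (of_int k)\<^sup>2 / 2 - m * (tilt m k - 1)) * tilt m k ^ N)"
proof -
  have single: "exp ((sqrt (real N) - sqrt m)\<^sup>2 / 4 - 1 / 2)
      \<le> (\<Sum>k\<in>{- int n..int n}. exp (- (of_int k)\<^sup>2 / 2 - m * (tilt m k - 1)) * tilt m k ^ N)"
    if "k \<in> {- int n..int n}"
      and "exp ((sqrt (real N) - sqrt m)\<^sup>2 / 4 - 1 / 2)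
        \<le> exp (- (of_int k)\<^sup>2 / 2 - m * (tilt m k - 1)) * tilt m k ^ N" for k
  proof -
    have "exp (- (of_int k)\<^sup>2 / 2 - m * (tilt m k - 1)) * tilt m k ^ N
      \<le> (\<Sum>k\<in>{- int n..int n}. exp (- (of_int k)\<^sup>2 / 2 - m * (tilt m k - 1)) * tilt m k ^ N)"
      using that(1) assms tilt_nonneg by (intro member_le_sum) auto
    then show ?thesis using that(2) by linarith
  qed
  show ?thesis
  proof (cases "m = 0")
    case True
    have "exp (real N / 4 - 1 / 2) \<le> exp (real N)" by simp
    then show ?thesis using True
      by (intro single[of 0]) (auto simp: tilt_def exp_of_nat_mult[symmetric])
  next
    case False
    then have "0 < m" using assms by simp
    define x where "x = sqrt (real N) - sqrt m"
    \<comment> \<open>\<open>k\<close> is \<open>x\<close> rounded towards zero, so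
      \<open>sqrt m + k\<close> lies between \<open>sqrt m\<close> and \<open>sqrt N\<close>, as
      \<open>tilt_power_ge\<close> requires.\<close>
    obtain k where k: "\<bar>x\<bar> \<le> \<bar>real_of_int k\<bar> + 1" "\<bar>real_of_int k\<bar> \<le> \<bar>x\<bar>"
        "0 < k \<Longrightarrow> real_of_int k \<le> x" "k < 0 \<Longrightarrow> x \<le> real_of_int k"
    proof (cases "0 \<le> x")
      case True
      then have "0 \<le> real_of_int \<lfloor>x\<rfloor>" by simp
      then show ?thesis using True floor_correct[of x]
        by (intro that[of "\<lfloor>x\<rfloor>"]) (auto simp: abs_of_nonneg)
    next
      case False
      then have "real_of_int \<lceil>x\<rceil> \<le> 0" by simp
      then show ?thesis using False ceiling_correct[of x]
        by (intro that[of "\<lceil>x\<rceil>"]) (auto simp: abs_of_nonpos)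
    qed
    have sqrt_bound: "sqrt m \<le> real n" "sqrt (real N) \<le> real n"
    proof -
      have "sqrt (real n) \<le> real n"
        by (cases n) (auto intro!: real_le_lsqrt simp: power2_eq_square)
      moreover have "sqrt m \<le> sqrt (real n)" "sqrt (real N) \<le> sqrt (real n)"
        using assms by auto
      ultimately show "sqrt m \<le> real n" "sqrt (real N) \<le> real n" by linarith+
    qed
    have "0 \<le> sqrt m" "0 \<le> sqrt (real N)" using assms by auto
    then have "\<bar>x\<bar> \<le> real n" using sqrt_bound unfolding x_def by linarith
    then have range: "k \<in> {- int n..int n}" using k(2) by (auto simp: abs_le_iff)
    have r: "0 \<le> sqrt m + of_int k"
    proof (cases "k < 0")
      case True
      then show ?thesis using k(4) \<open>0 \<le> sqrt (real N)\<close> unfolding x_def by linarith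
    next
      case False
      then show ?thesis using \<open>0 \<le> sqrt m\<close> by simp
    qed
    have "(sqrt m + of_int k)\<^sup>2 \<le> real N" if "0 < k"
      using power_mono[of "sqrt m + of_int k" "sqrt (real N)" 2] k(3)[OF that] r by (simp add: x_def)
    moreover have "real N \<le> (sqrt m + of_int k)\<^sup>2" if "k < 0"
      using power_mono[of "sqrt (real N)" "sqrt m + of_int k" 2] k(4)[OF that] by (simp add: x_def)
    ultimately have tilted: "exp ((of_int k)\<^sup>2) \<le> exp (- (m * (tilt m k - 1))) * tilt m k ^ N"
      using \<open>0 < m\<close> r by (intro tilt_power_ge) auto
    \<comment> \<open>\<open>x^2 <= 2 * k^2 + 2\<close> divided by 4 leaves \<open>k^2 / 2\<close>,
      the gain \<open>k^2\<close> less the prior cost; this fixes the constants \<open>1 / 4\<close>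
      and \<open>1 / 2\<close>.\<close>
    have "x\<^sup>2 \<le> (\<bar>real_of_int k\<bar> + 1)\<^sup>2"
      using k(1) by (intro abs_le_square_iff[THEN iffD1]) simp
    also have "\<dots> \<le> 2 * (of_int k)\<^sup>2 + 2"
      using zero_le_power2[of "\<bar>real_of_int k\<bar> - 1"] by (simp add: power2_eq_square algebra_simps)
    finally have "exp (x\<^sup>2 / 4 - 1 / 2) \<le> exp (- (of_int k)\<^sup>2 / 2) * exp ((of_int k)\<^sup>2)"
      by (simp add: exp_add[symmetric])
    also have "\<dots> \<le> exp (- (of_int k)\<^sup>2 / 2) * (exp (- (m * (tilt m k - 1))) * tilt m k ^ N)"
      using tilted by (intro mult_left_mono) auto
    also have "\<dots> = exp (- (of_int k)\<^sup>2 / 2 - m * (tilt m k - 1)) * tilt m k ^ N"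
      by (simp only: exp_add[symmetric] mult.assoc[symmetric]) simp
    finally show ?thesis using range by (intro single[of k]) (simp_all add: x_def)
  qed
qed

text \<open>Makes \<open>1 / 4 + exp (- 1) - 1\<close> at most \<open>- 3 / 8\<close> in both
  lower-tail bounds. The quadratic Taylor bound for \<open>exp\<close> at 1 gives only
  \<open>5 / 2\<close>; its fourth power at \<open>1 / 4\<close> exceeds
  \<open>8 / 3\<close>.\<close>

lemma exp_minus_one_le: "exp (- 1) \<le> (3 / 8 :: real)"
proof -
  have "(41 / 32 :: real) \<le> exp (1 / 4)"
    using exp_lower_Taylor_quadratic[of "1 / 4 :: real"] by (simp add: power2_eq_square)
  then have "(41 / 32) ^ 4 \<le> (exp (1 / 4) :: real) ^ 4" by (intro power_mono) auto
  also have "\<dots> = exp 1" by (simp add: exp_of_nat_mult[of 4, symmetric, simplified])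
  finally have "8 / 3 \<le> exp (1 :: real)" by (simp add: power_divide)
  then show ?thesis by (simp add: exp_minus field_simps)
qed

section \<open>Multinomial counts and their generating function\<close>

locale multinomial_sample = prob_space M for M :: "'w measure" +
  fixes n d :: nat and p :: "nat \<Rightarrow> real" and X :: "nat \<Rightarrow> 'w \<Rightarrow> nat"
  assumes prob_vector: "p \<in> prob_vectors d"
    and indep: "indep_vars (\<lambda>_. count_space {1..d}) X {1..n}"
    and distr: "i \<in> {1..n} \<Longrightarrow> distributed M (count_space {1..d}) (X i) (\<lambda>j. ennreal (p j))"
begin

abbreviation N :: "nat \<Rightarrow> 'w \<Rightarrow> nat" where
  "N j \<omega> \<equiv> occurrences n (\<lambda>i. X i \<omega>) j"

abbreviation \<mu> :: "nat \<Rightarrow> real" where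
  "\<mu> j \<equiv> real n * p j"

lemma p_nonneg: "j \<in> {1..d} \<Longrightarrow> 0 \<le> p j"
  and sum_p: "(\<Sum>j\<in>{1..d}. p j) = 1"
  using prob_vector by (auto simp: prob_vectors_def)

lemma p_le_1: "j \<in> {1..d} \<Longrightarrow> p j \<le> 1"
  using member_le_sum[of j "{1..d}" p] p_nonneg sum_p by auto

lemma measurable_X: "i \<in> {1..n} \<Longrightarrow> X i \<in> measurable M (count_space {1..d})"
  using distr distributed_measurable by blast

lemma X_range: "i \<in> {1..n} \<Longrightarrow> \<omega> \<in> space M \<Longrightarrow> X i \<omega> \<in> {1..d}"
  using measurable_space[OF measurable_X] by force

lemma measurable_N [measurable]: "N j \<in> measurable M (count_space UNIV)"
  unfolding occurrences_def
proof (rule measurable_sum_nat)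
  fix i assume "i \<in> {1..n}"
  have "(\<lambda>k. of_bool (k = j) :: nat) \<in> measurable (count_space {1..d}) (count_space UNIV)"
    by simp
  from measurable_compose[OF measurable_X[OF \<open>i \<in> {1..n}\<close>] this]
  show "(\<lambda>\<omega>. of_bool (X i \<omega> = j) :: nat) \<in> measurable M (count_space UNIV)" .
qed

lemma sum_N: "\<omega> \<in> space M \<Longrightarrow> (\<Sum>j\<in>{1..d}. N j \<omega>) = n"
  unfolding occurrences_def using X_range by (subst sum.swap) (simp add: of_bool_def)

lemma N_le: "N j \<omega> \<le> n"
  unfolding occurrences_def
  using sum_bounded_above[of "{1..n}" "\<lambda>i. of_bool (X i \<omega> = j)" "1::nat"] by simp

text \<open>Regrouping by draws turns a product over dependent counts into one over independent
  draws, whose expectation factorizes.\<close>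

lemma prod_power_N:
  fixes y :: "nat \<Rightarrow> real"
  assumes "\<omega> \<in> space M"
  shows "(\<Prod>j\<in>{1..d}. y j ^ N j \<omega>) = (\<Prod>i\<in>{1..n}. y (X i \<omega>))"
proof -
  have "(\<Prod>j\<in>{1..d}. y j ^ N j \<omega>) = (\<Prod>i\<in>{1..n}. \<Prod>j\<in>{1..d}. y j ^ of_bool (X i \<omega> = j))"
    unfolding occurrences_def power_sum by (rule prod.swap)
  also have "\<dots> = (\<Prod>i\<in>{1..n}. y (X i \<omega>))"
  proof (rule prod.cong[OF refl])
    fix i assume "i \<in> {1..n}"
    have "(\<Prod>j\<in>{1..d}. y j ^ of_bool (X i \<omega> = j)) = (\<Prod>j\<in>{1..d}. if X i \<omega> = j then y j else 1)"
      by (rule prod.cong) auto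
    then show "(\<Prod>j\<in>{1..d}. y j ^ of_bool (X i \<omega> = j)) = y (X i \<omega>)"
      using X_range[OF \<open>i \<in> {1..n}\<close> assms] by simp
  qed
  finally show ?thesis .
qed

lemma integrable_prod_power_N: "integrable M (\<lambda>\<omega>. \<Prod>j\<in>{1..d}. (y j :: real) ^ N j \<omega>)"
  and expectation_prod_power_N:
    "expectation (\<lambda>\<omega>. \<Prod>j\<in>{1..d}. y j ^ N j \<omega>) = (\<Sum>j\<in>{1..d}. p j * y j) ^ n"
proof -
  have indep': "indep_vars (\<lambda>_. borel) (\<lambda>i \<omega>. y (X i \<omega>)) {1..n}"
    by (rule indep_vars_compose2[OF indep]) simp
  have int: "integrable M (\<lambda>\<omega>. y (X i \<omega>))"
    and expect: "expectation (\<lambda>\<omega>. y (X i \<omega>)) = (\<Sum>j\<in>{1..d}. p j * y j)" if "i \<in> {1..n}" for i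
    using distributed_integrable[OF distr[OF that], of y]
      distributed_integral[OF distr[OF that], of y] p_nonneg
    by (simp_all add: integrable_count_space lebesgue_integral_count_space_finite)
  have "integrable M (\<lambda>\<omega>. \<Prod>i\<in>{1..n}. y (X i \<omega>))"
    by (rule indep_vars_integrable[OF _ indep' int]) auto
  then show "integrable M (\<lambda>\<omega>. \<Prod>j\<in>{1..d}. y j ^ N j \<omega>)"
    by (rule Bochner_Integration.integrable_cong[THEN iffD1, rotated -1]) (simp_all only: prod_power_N)
  have "expectation (\<lambda>\<omega>. \<Prod>j\<in>{1..d}. y j ^ N j \<omega>) = expectation (\<lambda>\<omega>. \<Prod>i\<in>{1..n}. y (X i \<omega>))"
    by (rule Bochner_Integration.integral_cong) (simp_all only: prod_power_N)
  also have "\<dots> = (\<Sum>j\<in>{1..d}. p j * y j) ^ n"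
    by (subst indep_vars_lebesgue_integral[OF _ indep' int]) (auto simp: expect)
  finally show "expectation (\<lambda>\<omega>. \<Prod>j\<in>{1..d}. y j ^ N j \<omega>) = (\<Sum>j\<in>{1..d}. p j * y j) ^ n" .
qed

text \<open>As \<open>p\<close> sums to 1, the mean of \<open>y\<close> is 1 plus the mean of
  \<open>y - 1\<close>, and \<open>1 + x <= exp x\<close> applies. The result is the generating
  function of independent Poisson counts.\<close>

lemma expectation_prod_power_N_le:
  assumes "\<And>j. j \<in> {1..d} \<Longrightarrow> 0 \<le> y j"
  shows "expectation (\<lambda>\<omega>. \<Prod>j\<in>{1..d}. y j ^ N j \<omega>) \<le> exp (\<Sum>j\<in>{1..d}. \<mu> j * (y j - 1))"
proof -
  have "(\<Sum>j\<in>{1..d}. p j * y j) = 1 + (\<Sum>j\<in>{1..d}. p j * (y j - 1))"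
    using sum_p by (simp add: algebra_simps sum_subtractf)
  also have "\<dots> \<le> exp (\<Sum>j\<in>{1..d}. p j * (y j - 1))"
    by (rule exp_ge_add_one_self)
  finally have "(\<Sum>j\<in>{1..d}. p j * y j) ^ n \<le> exp (\<Sum>j\<in>{1..d}. p j * (y j - 1)) ^ n"
    using assms p_nonneg by (intro power_mono sum_nonneg) auto
  also have "\<dots> = exp (\<Sum>j\<in>{1..d}. \<mu> j * (y j - 1))"
    by (simp add: exp_of_nat_mult[symmetric] sum_distrib_left mult.assoc)
  finally show ?thesis
    unfolding expectation_prod_power_N .
qed

section \<open>Tail bounds from positive mixtures of powers\<close>

text \<open>Markov's inequality for a positive combination of monomials; the event enters only
  through its inclusion in a superlevel set.\<close>

lemma posynomial_tail:
  assumes "finite C" and w: "\<And>c. c \<in> C \<Longrightarrow> 0 \<le> w c"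
    and y: "\<And>c j. c \<in> C \<Longrightarrow> j \<in> {1..d} \<Longrightarrow> 0 \<le> y c j" and "0 < t"
    and E: "\<And>\<omega>. \<omega> \<in> space M \<Longrightarrow> E \<omega> \<Longrightarrow> t \<le> (\<Sum>c\<in>C. w c * (\<Prod>j\<in>{1..d}. y c j ^ N j \<omega>))"
  shows "\<P>(\<omega> in M. E \<omega>) \<le> (\<Sum>c\<in>C. w c * exp (\<Sum>j\<in>{1..d}. \<mu> j * (y c j - 1))) / t"
proof -
  let ?Z = "\<lambda>\<omega>. \<Sum>c\<in>C. w c * (\<Prod>j\<in>{1..d}. y c j ^ N j \<omega>)"
  have int: "integrable M ?Z"
    by (intro Bochner_Integration.integrable_sum integrable_mult_right integrable_prod_power_N)
  note [measurable] = borel_measurable_integrable[OF int]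
  have "\<P>(\<omega> in M. E \<omega>) \<le> \<P>(\<omega> in M. t \<le> ?Z \<omega>)"
    using E by (intro finite_measure_mono) auto
  also have "\<dots> \<le> expectation ?Z / t"
    by (rule integral_Markov_inequality_measure[OF int, of "space M"])
       (use assms in \<open>auto intro!: sum_nonneg mult_nonneg_nonneg prod_nonneg\<close>)
  also have "expectation ?Z = (\<Sum>c\<in>C. w c * expectation (\<lambda>\<omega>. \<Prod>j\<in>{1..d}. y c j ^ N j \<omega>))"
    by (subst Bochner_Integration.integral_sum)
       (simp_all only: integrable_mult_right integrable_prod_power_N integral_mult_right_zero)
  also have "\<dots> / t \<le> (\<Sum>c\<in>C. w c * exp (\<Sum>j\<in>{1..d}. \<mu> j * (y c j - 1))) / t"
    using assms by (intro divide_right_mono sum_mono mult_left_mono expectation_prod_power_N_le) auto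
  finally show ?thesis .
qed

text \<open>
  In the exponential-moment bound for a single tilt the right-hand side factorizes as if the counts
  were independent Poisson variables; expanding the product transfers this to all positive mixtures.
\<close>

lemma mixture_tail:
  fixes K :: "nat \<Rightarrow> 'k set"
  assumes K: "\<And>j. j \<in> {1..d} \<Longrightarrow> finite (K j)"
    and w: "\<And>j k. j \<in> {1..d} \<Longrightarrow> k \<in> K j \<Longrightarrow> 0 \<le> w j k"
    and y: "\<And>j k. j \<in> {1..d} \<Longrightarrow> k \<in> K j \<Longrightarrow> 0 \<le> y j k" and "0 < t"
    and E: "\<And>\<omega>. \<omega> \<in> space M \<Longrightarrow> E \<omega> \<Longrightarrow> t \<le> (\<Prod>j\<in>{1..d}. \<Sum>k\<in>K j. w j k * y j k ^ N j \<omega>)"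
  shows "\<P>(\<omega> in M. E \<omega>)
    \<le> (\<Prod>j\<in>{1..d}. \<Sum>k\<in>K j. w j k * exp (\<mu> j * (y j k - 1))) / t"
proof -
  let ?C = "PiE {1..d} K"
  have expand: "(\<Prod>j\<in>{1..d}. \<Sum>k\<in>K j. w j k * y j k ^ N j \<omega>)
      = (\<Sum>c\<in>?C. (\<Prod>j\<in>{1..d}. w j (c j)) * (\<Prod>j\<in>{1..d}. y j (c j) ^ N j \<omega>))" for \<omega>
    using K by (subst prod_sum_PiE) (auto simp: prod.distrib)
  have "(\<Prod>j\<in>{1..d}. \<Sum>k\<in>K j. w j k * exp (\<mu> j * (y j k - 1)))
      = (\<Sum>c\<in>?C. (\<Prod>j\<in>{1..d}. w j (c j)) * exp (\<Sum>j\<in>{1..d}. \<mu> j * (y j (c j) - 1)))"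
    using K by (subst prod_sum_PiE) (auto simp: prod.distrib exp_sum)
  moreover have "\<P>(\<omega> in M. E \<omega>)
    \<le> (\<Sum>c\<in>?C. (\<Prod>j\<in>{1..d}. w j (c j)) * exp (\<Sum>j\<in>{1..d}. \<mu> j * (y j (c j) - 1))) / t"
  proof (rule posynomial_tail)
    show "finite ?C" using K by (intro finite_PiE) auto
    show "0 \<le> (\<Prod>j\<in>{1..d}. w j (c j))" if "c \<in> ?C" for c
      using w that by (intro prod_nonneg) (auto dest: PiE_mem)
    show "0 \<le> y j (c j)" if "c \<in> ?C" "j \<in> {1..d}" for c j
      using y that by (auto dest: PiE_mem)
  qed (use E \<open>0 < t\<close> in \<open>auto simp only: expand\<close>)
  ultimately show ?thesis by simp
qed

text \<open>
  For a Gaussian mixture of tilts every factor of the moment bound is at most \<open>exp 2\<close>, uniformly in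
  the means.
\<close>

lemma hellinger_tail:
  assumes "0 < \<delta>"
  shows "\<P>(\<omega> in M. 10 * real d + 4 * ln (1 / \<delta>)
      \<le> (\<Sum>j\<in>{1..d}. (sqrt (real (N j \<omega>)) - sqrt (\<mu> j))\<^sup>2)) \<le> \<delta>"
proof -
  let ?K = "{- int n..int n}"
  let ?w = "\<lambda>j k. exp (- (of_int k)\<^sup>2 / 2 - \<mu> j * (tilt (\<mu> j) k - 1))"
  \<comment> \<open>The image of the threshold under \<open>s / 4 - d / 2\<close> followed by
    \<open>exp\<close>; the factor \<open>exp (2 * d)\<close> cancels the moment bound.\<close>
  let ?t = "exp (2 * real d) / \<delta>"
  have "\<P>(\<omega> in M. 10 * real d + 4 * ln (1 / \<delta>)
      \<le> (\<Sum>j\<in>{1..d}. (sqrt (real (N j \<omega>)) - sqrt (\<mu> j))\<^sup>2))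
    \<le> (\<Prod>j\<in>{1..d}. \<Sum>k\<in>?K. ?w j k * exp (\<mu> j * (tilt (\<mu> j) k - 1))) / ?t"
  proof (rule mixture_tail)
    fix \<omega> assume "\<omega> \<in> space M"
      and H: "10 * real d + 4 * ln (1 / \<delta>) \<le> (\<Sum>j\<in>{1..d}. (sqrt (real (N j \<omega>)) - sqrt (\<mu> j))\<^sup>2)"
    have "?t = exp (2 * real d + ln (1 / \<delta>))"
      using assms by (simp add: exp_add)
    also have "\<dots> \<le> exp (\<Sum>j\<in>{1..d}. (sqrt (real (N j \<omega>)) - sqrt (\<mu> j))\<^sup>2 / 4 - 1 / 2)"
      using H by (simp add: sum_subtractf sum_divide_distrib[symmetric])
    also have "\<dots> = (\<Prod>j\<in>{1..d}. exp ((sqrt (real (N j \<omega>)) - sqrt (\<mu> j))\<^sup>2 / 4 - 1 / 2))"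
      by (simp add: exp_sum)
    also have "\<dots> \<le> (\<Prod>j\<in>{1..d}. \<Sum>k\<in>?K. ?w j k * tilt (\<mu> j) k ^ N j \<omega>)"
    proof (intro prod_mono conjI exp_hellinger_le_mixture)
      fix j assume j: "j \<in> {1..d}"
      show "\<mu> j \<le> real n" using p_le_1[OF j] p_nonneg[OF j] by (simp add: mult_left_le)
    qed (use p_nonneg N_le in auto)
    finally show "?t \<le> (\<Prod>j\<in>{1..d}. \<Sum>k\<in>?K. ?w j k * tilt (\<mu> j) k ^ N j \<omega>)" .
  qed (use assms p_nonneg tilt_nonneg in auto)
  \<comment> \<open>The weights contain the inverse of each Poisson moment, so only the Gaussian
    prior remains.\<close>
  also have "(\<Prod>j\<in>{1..d}. \<Sum>k\<in>?K. ?w j k * exp (\<mu> j * (tilt (\<mu> j) k - 1)))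
      = (\<Prod>j\<in>{1..d}. \<Sum>k\<in>?K. exp (- (of_int k)\<^sup>2 / 2))"
    by (simp add: exp_add[symmetric])
  also have "\<dots> \<le> (\<Prod>j\<in>{1..d}. exp 2)"
    using sum_gaussian_weights_le by (intro prod_mono) (auto intro!: sum_nonneg)
  also have "\<dots> = exp (2 * real d)"
    by (simp add: exp_of_nat_mult[symmetric] mult.commute)
  also have "exp (2 * real d) / ?t = \<delta>" by simp
  finally show ?thesis using assms by (simp add: divide_right_mono)
qed

text \<open>A Chernoff bound with tilt \<open>exp (- 1)\<close> on a single letter gives
  \<open>\<delta> / d\<close>; a union bound over \<open>J\<close> does the rest.\<close>

lemma lower_tail_large_means:
  assumes "0 < \<delta>" "0 < d" "J \<subseteq> {1..d}"
    and large: "\<And>j. j \<in> J \<Longrightarrow> 3 * (ln (1 / \<delta>) + ln (real d)) \<le> \<mu> j"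
  shows "\<P>(\<omega> in M. \<exists>j\<in>J. real (N j \<omega>) < \<mu> j / 4) \<le> \<delta>"
proof -
  let ?y = "\<lambda>c j. if j = c then exp (- 1) else 1 :: real"
  have fin: "finite J" using assms finite_subset by blast
  have pow: "(\<Prod>j\<in>{1..d}. ?y c j ^ N j \<omega>) = exp (- real (N c \<omega>))" if "c \<in> J" for c \<omega>
  proof -
    have "(\<Prod>j\<in>{1..d}. ?y c j ^ N j \<omega>) = (\<Prod>j\<in>{1..d}. if j = c then exp (- 1) ^ N c \<omega> else 1)"
      by (rule prod.cong) auto
    also have "\<dots> = exp (- real (N c \<omega>))"
      using that assms(3) by (auto simp: exp_of_nat_mult[symmetric])
    finally show ?thesis .
  qed
  have "\<P>(\<omega> in M. \<exists>j\<in>J. real (N j \<omega>) < \<mu> j / 4)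
      \<le> (\<Sum>c\<in>J. exp (\<mu> c / 4) * exp (\<Sum>j\<in>{1..d}. \<mu> j * (?y c j - 1))) / 1"
  proof (rule posynomial_tail[OF fin])
    fix \<omega> assume "\<exists>j\<in>J. real (N j \<omega>) < \<mu> j / 4"
    then obtain i where i: "i \<in> J" "real (N i \<omega>) < \<mu> i / 4" by blast
    then have "1 \<le> exp (\<mu> i / 4) * exp (- real (N i \<omega>))" by (simp add: exp_add[symmetric])
    also have "\<dots> \<le> (\<Sum>c\<in>J. exp (\<mu> c / 4) * exp (- real (N c \<omega>)))"
      using i fin by (intro member_le_sum[where f = "\<lambda>c. exp (\<mu> c / 4) * exp (- real (N c \<omega>))"]) auto
    also have "\<dots> = (\<Sum>c\<in>J. exp (\<mu> c / 4) * (\<Prod>j\<in>{1..d}. ?y c j ^ N j \<omega>))"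
      by (rule sum.cong) (simp_all only: pow)
    finally show "1 \<le> (\<Sum>c\<in>J. exp (\<mu> c / 4) * (\<Prod>j\<in>{1..d}. ?y c j ^ N j \<omega>))" .
  qed auto
  also have "\<dots> \<le> (\<Sum>c\<in>J. \<delta> / real d)"
    unfolding div_by_1
  proof (rule sum_mono)
    fix c assume c: "c \<in> J"
    then have "0 \<le> \<mu> c" using assms(3) p_nonneg by auto
    have "(\<Sum>j\<in>{1..d}. \<mu> j * (?y c j - 1)) = (\<Sum>j\<in>{1..d}. if j = c then \<mu> c * (exp (- 1) - 1) else 0)"
      by (rule sum.cong) auto
    also have "\<dots> = \<mu> c * (exp (- 1) - 1)" using c assms(3) by auto
    also have "\<dots> \<le> \<mu> c * (3 / 8 - 1)"
      using \<open>0 \<le> \<mu> c\<close> exp_minus_one_le by (intro mult_left_mono) auto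
    \<comment> \<open>The exponent is at most \<open>- 3 / 8 * \<mu> c\<close>, while
      \<open>large\<close> bounds \<open>ln (1 / \<delta>) + ln d\<close> by
      \<open>\<mu> c / 3\<close>.\<close>
    finally have "exp (\<mu> c / 4) * exp (\<Sum>j\<in>{1..d}. \<mu> j * (?y c j - 1))
        \<le> exp (- (ln (1 / \<delta>) + ln (real d)))"
      using large[OF c] \<open>0 \<le> \<mu> c\<close> by (simp add: exp_add[symmetric])
    also have "\<dots> = \<delta> / real d"
      using assms by (simp add: exp_add exp_minus exp_diff ln_div)
    finally show "exp (\<mu> c / 4) * exp (\<Sum>j\<in>{1..d}. \<mu> j * (?y c j - 1)) \<le> \<delta> / real d" .
  qed
  also have "\<dots> \<le> real d * (\<delta> / real d)"
    unfolding sum_constant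
    using card_mono[OF _ \<open>J \<subseteq> {1..d}\<close>] assms by (intro mult_right_mono) auto
  also have "\<dots> = \<delta>" using assms by simp
  finally show ?thesis .
qed

text \<open>
  The exponent \<open>3 / (16 * B)\<close> is so small that the factor \<open>exp (\<mu> j * l j * 3 / (16 * B))\<close> is
  absorbed by half of the exponent \<open>3 * \<mu> j / 8\<close> in the probability of a small count.
\<close>

lemma weighted_lower_tail:
  assumes "0 < \<delta>" "0 < B"
    and l: "\<And>j. j \<in> {1..d} \<Longrightarrow> 0 \<le> l j" "\<And>j. j \<in> {1..d} \<Longrightarrow> l j \<le> B"
      "\<And>j. j \<in> {1..d} \<Longrightarrow> l j \<le> \<mu> j"
  shows "\<P>(\<omega> in M. 57 * real d + 16 / 3 * B * ln (1 / \<delta>)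
    \<le> (\<Sum>j\<in>{1..d}. \<mu> j * l j * of_bool (real (N j \<omega>) < \<mu> j / 4))) \<le> \<delta>"
proof -
  define c where "c = 3 / (16 * B)"
  have "0 < c" using assms by (simp add: c_def)
  let ?x = "\<lambda>j. c * (\<mu> j * l j)"
  \<comment> \<open>Two components per letter, one tilted and one constant: the mixture is
    \<open>1 + x * exp x * exp (\<mu> / 4 - N)\<close>.\<close>
  let ?w = "\<lambda>j k. if k then ?x j * exp (?x j) * exp (\<mu> j / 4) else 1"
  let ?y = "\<lambda>(j :: nat) k. if k then exp (- 1) else 1 :: real"
  let ?t = "exp (57 * c * real d) / \<delta>"
  have x: "0 \<le> ?x j" if "j \<in> {1..d}" for j
    using that \<open>0 < c\<close> l p_nonneg by simp
  have "\<P>(\<omega> in M. 57 * real d + 16 / 3 * B * ln (1 / \<delta>)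
      \<le> (\<Sum>j\<in>{1..d}. \<mu> j * l j * of_bool (real (N j \<omega>) < \<mu> j / 4)))
    \<le> (\<Prod>j\<in>{1..d}. \<Sum>k\<in>UNIV. ?w j k * exp (\<mu> j * (?y j k - 1))) / ?t"
  proof (rule mixture_tail)
    fix \<omega> assume "\<omega> \<in> space M"
    let ?T = "\<Sum>j\<in>{1..d}. \<mu> j * l j * of_bool (real (N j \<omega>) < \<mu> j / 4)"
    assume "57 * real d + 16 / 3 * B * ln (1 / \<delta>) \<le> ?T"
    then have "c * (57 * real d + 16 / 3 * B * ln (1 / \<delta>)) \<le> c * ?T"
      using \<open>0 < c\<close> by (intro mult_left_mono) auto
    moreover have "c * (57 * real d + 16 / 3 * B * ln (1 / \<delta>)) = 57 * c * real d + ln (1 / \<delta>)"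
      using assms by (simp add: c_def field_simps)
    ultimately have "exp (57 * c * real d + ln (1 / \<delta>)) \<le> exp (c * ?T)" by simp
    moreover have "exp (57 * c * real d + ln (1 / \<delta>)) = ?t" using assms by (simp add: exp_add)
    ultimately have "?t \<le> exp (c * ?T)" by simp
    also have "\<dots> = (\<Prod>j\<in>{1..d}. exp (?x j * of_bool (real (N j \<omega>) < \<mu> j / 4)))"
      by (simp add: exp_sum sum_distrib_left mult.assoc)
    also have "\<dots> \<le> (\<Prod>j\<in>{1..d}. \<Sum>k\<in>UNIV. ?w j k * ?y j k ^ N j \<omega>)"
    proof (intro prod_mono conjI)
      fix j assume j: "j \<in> {1..d}"
      have "exp (\<mu> j / 4 - real (N j \<omega>)) = exp (\<mu> j / 4) * exp (- 1) ^ N j \<omega>"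
        by (simp add: exp_of_nat_mult[symmetric] exp_add[symmetric])
      then have sum: "(\<Sum>k\<in>UNIV. ?w j k * ?y j k ^ N j \<omega>)
          = 1 + ?x j * exp (?x j) * exp (\<mu> j / 4 - real (N j \<omega>))"
        by (simp only:) (simp add: UNIV_bool)
      show "exp (?x j * of_bool (real (N j \<omega>) < \<mu> j / 4)) \<le> (\<Sum>k\<in>UNIV. ?w j k * ?y j k ^ N j \<omega>)"
      proof (cases "real (N j \<omega>) < \<mu> j / 4")
        case True
        \<comment> \<open>This yields \<open>exp x <= 1 + x * exp x\<close>. The prefactor
          \<open>x\<close>, proportional to \<open>c\<close>, is what later gives a moment of
          \<open>exp (57 * c)\<close>.\<close>
        have "(1 - ?x j) * exp (?x j) \<le> exp (- ?x j) * exp (?x j)"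
          using exp_ge_add_one_self[of "- ?x j"] by (intro mult_right_mono) auto
        then have "exp (?x j) \<le> 1 + ?x j * exp (?x j) * 1"
          by (simp add: exp_minus algebra_simps)
        also have "\<dots> \<le> 1 + ?x j * exp (?x j) * exp (\<mu> j / 4 - real (N j \<omega>))"
          using x[OF j] True by (intro add_left_mono mult_left_mono) auto
        finally show ?thesis using True unfolding sum by simp
      next
        case False
        then show ?thesis using x[OF j] unfolding sum by simp
      qed
    qed auto
    finally show "?t \<le> (\<Prod>j\<in>{1..d}. \<Sum>k\<in>UNIV. ?w j k * ?y j k ^ N j \<omega>)" .
  qed (use assms x in auto)
  also have "\<dots> \<le> (\<Prod>j\<in>{1..d}. exp (57 * c)) / ?t"
  proof (intro divide_right_mono prod_mono conjI)
    fix j assume j: "j \<in> {1..d}"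
    have \<mu>: "0 \<le> \<mu> j" using p_nonneg[OF j] by simp
    show "0 \<le> (\<Sum>k\<in>UNIV. ?w j k * exp (\<mu> j * (?y j k - 1)))"
      using x[OF j] by (intro sum_nonneg) auto
    have "c * l j \<le> c * B" using l j \<open>0 < c\<close> by (intro mult_left_mono) auto
    then have "c * l j \<le> 3 / 16" using \<open>0 < B\<close> by (simp add: c_def)
    then have "?x j \<le> 3 / 16 * \<mu> j"
      using mult_right_mono[of "c * l j" "3 / 16" "\<mu> j"] \<mu> by (simp add: algebra_simps)
    moreover have "\<mu> j * (exp (- 1) - 1) \<le> \<mu> j * (3 / 8 - 1)"
      using \<mu> exp_minus_one_le by (intro mult_left_mono) auto
    \<comment> \<open>The sum is \<open>3 / 16 + 1 / 4 - 5 / 8 = - 3 / 16\<close>.\<close>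
    ultimately have e: "?x j + \<mu> j / 4 + \<mu> j * (exp (- 1) - 1) \<le> - (3 / 16 * \<mu> j)" by simp
    have "(\<Sum>k\<in>UNIV. ?w j k * exp (\<mu> j * (?y j k - 1)))
        = 1 + ?x j * exp (?x j + \<mu> j / 4 + \<mu> j * (exp (- 1) - 1))"
      by (simp add: UNIV_bool exp_add)
    \<comment> \<open>The bound \<open>l j <= \<mu> j\<close> makes the prefactor quadratic in
      \<open>\<mu> j\<close>, so the exponential can absorb it.\<close>
    also have "\<dots> \<le> 1 + c * (\<mu> j * \<mu> j) * exp (- (3 / 16 * \<mu> j))"
      using e \<open>0 < c\<close> l(1,3)[OF j] \<mu> by (intro add_left_mono mult_mono mult_left_mono) auto
    also have "\<dots> = 1 + c * (\<mu> j * \<mu> j * exp (- (3 / 16 * \<mu> j)))"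
      by simp
    also have "\<dots> \<le> 1 + c * 57"
    proof -
      \<comment> \<open>57 exceeds \<open>512 / 9\<close>, the reciprocal of
        \<open>(3 / 16)^2 / 2\<close>.\<close>
      have "\<mu> j * \<mu> j \<le> 57 * ((3 / 16 * \<mu> j)\<^sup>2 / 2)"
        using \<mu> by (simp add: power2_eq_square)
      also have "\<dots> \<le> 57 * exp (3 / 16 * \<mu> j)"
        using exp_lower_Taylor_quadratic[of "3 / 16 * \<mu> j"] \<mu> by (intro mult_left_mono) auto
      finally have "\<mu> j * \<mu> j * exp (- (3 / 16 * \<mu> j)) \<le> 57"
        by (simp add: exp_minus field_simps)
      then show ?thesis using \<open>0 < c\<close> by simp
    qed
    also have "\<dots> \<le> exp (57 * c)"
      using exp_ge_add_one_self[of "57 * c"] by (simp add: mult.commute)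
    finally show "(\<Sum>k\<in>UNIV. ?w j k * exp (\<mu> j * (?y j k - 1))) \<le> exp (57 * c)" .
  qed (use assms in auto)
  also have "\<dots> = \<delta>"
    by (simp add: exp_of_nat_mult[symmetric] algebra_simps)
  finally show ?thesis .
qed

end

section \<open>Deterministic bounds for the smoothed estimator\<close>

text \<open>If \<open>N + l >= m / 4\<close>, the two scalar lemmas combine, with
  \<open>18 = 9 * 2\<close>; the cut-off at 0 keeps the last term nonnegative. Otherwise
  \<open>- m + N + l\<close> is negative and \<open>N + l >= l\<close> bounds the logarithm.\<close>

lemma smoothed_relative_entropy_le:
  fixes m l :: real and N :: nat
  assumes "0 \<le> m" "0 < l"
  shows "m * ln (m / (real N + l)) - m + (real N + l)
    \<le> 18 * (sqrt (real N) - sqrt m)\<^sup>2 + 18 * l + m * max 0 (ln (m / l)) * of_bool (real N < m / 4)"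
proof (cases "m / 4 \<le> real N + l")
  case True
  have "m * ln (m / (real N + l)) - m + (real N + l) \<le> 9 * (sqrt (real N + l) - sqrt m)\<^sup>2"
    using assms True by (intro relative_entropy_le_hellinger) auto
  also have "\<dots> \<le> 18 * (sqrt (real N) - sqrt m)\<^sup>2 + 18 * l"
    using sqrt_shift_diff_le[of "real N" l m] assms by simp
  also have "\<dots> \<le> \<dots> + m * max 0 (ln (m / l)) * of_bool (real N < m / 4)"
    using assms by simp
  finally show ?thesis .
next
  case False
  then have "0 < m" "real N < m / 4" using assms by auto
  define z where "z = max 0 (ln (m / l))"
  have "m * ln (m / (real N + l)) \<le> m * z"
    unfolding z_def
    using \<open>0 < m\<close> \<open>0 < l\<close>
    by (intro mult_left_mono max.coboundedI2) (auto intro!: divide_left_mono)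
  moreover have "0 \<le> 18 * (sqrt (real N) - sqrt m)\<^sup>2 + 18 * l" using assms by simp
  moreover have "of_bool (real N < m / 4) = (1 :: real)" using \<open>real N < m / 4\<close> by simp
  ultimately show ?thesis using False \<open>0 < m\<close> unfolding z_def[symmetric] by (simp only: mult_1_right)
qed

lemma KL_eq_sum:
  assumes "\<And>j. j \<in> {1..d} \<Longrightarrow> 0 < q j"
  shows "KL d p q = ereal (\<Sum>j\<in>{1..d}. p j * ln (p j / q j))"
proof -
  have "KL d p q = (\<Sum>j\<in>{1..d}. ereal (p j * ln (p j / q j)))"
    unfolding KL_def kl_term_def using assms by (intro sum.cong) fastforce+
  then show ?thesis by simp
qed

text \<open>
  Since the counts sum to \<open>n\<close>, the normalization costs only \<open>n * ln (1 + l * d / n) \<le> l * d\<close>, which is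
  what the linear terms on the right add up to.
\<close>

lemma scaled_KL_smoothed_le:
  fixes n d :: nat and p :: "nat \<Rightarrow> real" and N :: "nat \<Rightarrow> nat" and l :: real
  assumes "p \<in> prob_vectors d" "0 < n" "0 < l" and N: "(\<Sum>j\<in>{1..d}. N j) = n"
  shows "real n * (\<Sum>j\<in>{1..d}. p j * ln (p j / ((real (N j) + l) / (real n + l * real d))))
    \<le> (\<Sum>j\<in>{1..d}. real n * p j * ln (real n * p j / (real (N j) + l)) - real n * p j + (real (N j) + l))"
proof -
  have p: "\<And>j. j \<in> {1..d} \<Longrightarrow> 0 \<le> p j" "(\<Sum>j\<in>{1..d}. p j) = 1"
    using assms by (auto simp: prob_vectors_def)
  let ?s = "1 + l * real d / real n"
  have "0 < ?s" using assms by (simp add: add_pos_nonneg)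
  have summand: "p j * ln (p j / ((real (N j) + l) / (real n + l * real d)))
      = p j * ln (real n * p j / (real (N j) + l)) + p j * ln ?s" if "j \<in> {1..d}" for j
  proof (cases "p j = 0")
    case False
    then have "0 < p j" using p(1)[OF that] by simp
    have "p j / ((real (N j) + l) / (real n + l * real d)) = real n * p j / (real (N j) + l) * ?s"
    proof -
      have "?s = (real n + l * real d) / real n" using \<open>0 < n\<close> by (simp add: field_simps)
      then show ?thesis using \<open>0 < n\<close> by simp
    qed
    then have "ln (p j / ((real (N j) + l) / (real n + l * real d)))
        = ln (real n * p j / (real (N j) + l)) + ln ?s"
      using \<open>0 < p j\<close> \<open>0 < ?s\<close> \<open>0 < n\<close> \<open>0 < l\<close> by (simp only:) (subst ln_mult_pos; simp add: add_nonneg_pos)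
    then show ?thesis by (simp only: distrib_left)
  qed simp
  have "real n * (\<Sum>j\<in>{1..d}. p j * ln (p j / ((real (N j) + l) / (real n + l * real d))))
      = real n * (\<Sum>j\<in>{1..d}. p j * ln (real n * p j / (real (N j) + l)) + p j * ln ?s)"
    by (simp only: summand cong: sum.cong)
  also have "\<dots> = (\<Sum>j\<in>{1..d}. real n * p j * ln (real n * p j / (real (N j) + l))) + real n * ln ?s"
    using p(2) by (simp add: sum.distrib sum_distrib_left sum_distrib_right[symmetric] algebra_simps)
  also have "real n * ln ?s \<le> real n * (l * real d / real n)"
    using assms by (intro mult_left_mono ln_add_one_self_le_self) auto
  also have "\<dots> = (\<Sum>j\<in>{1..d}. - (real n * p j) + (real (N j) + l))"
    using \<open>0 < n\<close> p(2) arg_cong[OF N, of real]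
    by (simp add: sum.distrib sum_subtractf sum_distrib_left[symmetric])
  finally show ?thesis by (simp add: sum.distrib sum_subtractf sum_negf)
qed

section \<open>Combination of the three exceptional events\<close>

theorem theorem3:
  fixes n d :: nat and \<delta> :: real and p :: "nat \<Rightarrow> real"
    and M :: "'w measure" and X :: "nat \<Rightarrow> 'w \<Rightarrow> nat"
  assumes "n \<ge> 12" and "d \<ge> 2"
    and "exp (- (real n / 6)) < \<delta>" and "\<delta> < exp (- 2)"
    and "p \<in> prob_vectors d"
    and "iid_sample M n d p X"
  shows "\<P>(\<omega> in M. KL d p (estimator n d \<delta> (\<lambda>i. X i \<omega>))
           \<ge> ereal (110000 * ((real d + ln (real d) * ln (1 / \<delta>)) / real n))) \<le> 4 * \<delta>"
proof -
  interpret multinomial_sample M n d p X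
    using assms by (simp add: iid_sample_def multinomial_sample_def multinomial_sample_axioms_def)
  define L where "L = ln (1 / \<delta>)"
  define B where "B = 4 * ln (real d)"
  define l where "l = smoothing d \<delta>"
  have "0 < \<delta>" using assms(3) exp_gt_zero less_trans by blast
  have "0 < L"
  proof -
    have "\<delta> < 1" using assms(4) by (rule less_trans) simp
    then show ?thesis using \<open>0 < \<delta>\<close> by (simp add: L_def)
  qed
  have ln_d: "1 / 2 \<le> ln (real d)"
  proof -
    have "1 / 2 \<le> ln (2 :: real)" using ln2_ge_two_thirds by simp
    also have "\<dots> \<le> ln (real d)" using assms by simp
    finally show ?thesis .
  qed
  have ln_d_le: "ln (real d) \<le> real d" using ln_bound[of "real d"] assms by simp
  \<comment> \<open>\<open>l * d\<close> is the maximum of \<open>d\<close> and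
    \<open>L\<close>.\<close>
  have l: "1 \<le> l" "L \<le> l * real d" "real d \<le> l * real d" "l * real d \<le> real d + L"
    using assms \<open>0 < L\<close> by (auto simp: l_def smoothing_def L_def[symmetric] max_def field_simps)
  define small where "small j \<longleftrightarrow> \<mu> j < 3 * (L + ln (real d))" for j
  \<comment> \<open>Letters with large means get weight 0, since \<open>E2\<close> takes care of
    them; the bounds on \<open>v\<close> then hold for every letter.\<close>
  define v where "v j = (if small j then max 0 (ln (\<mu> j / l)) else 0)" for j
  have v: "0 \<le> v j" "v j \<le> B" "v j \<le> \<mu> j" if j: "j \<in> {1..d}" for j
  proof -
    have "0 \<le> \<mu> j" using p_nonneg[OF j] by simp
    have "0 \<le> B" using ln_d by (simp add: B_def)
    show "0 \<le> v j" by (simp add: v_def)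
    have "ln (\<mu> j / l) \<le> B \<and> ln (\<mu> j / l) \<le> \<mu> j" if "0 < \<mu> j" "small j"
    proof
      have "\<mu> j / l \<le> \<mu> j / 1" using that l(1) by (intro divide_left_mono) auto
      then have "ln (\<mu> j / l) \<le> ln (\<mu> j)"
        using divide_pos_pos[OF that(1), of l] that l(1) by (intro ln_mono) auto
      also have "\<dots> \<le> \<mu> j" using that(1) by (rule ln_bound)
      finally show "ln (\<mu> j / l) \<le> \<mu> j" .
      \<comment> \<open>\<open>L\<close> and \<open>ln d\<close> are both at most
        \<open>l * d\<close>, so \<open>\<mu> j / l <= 6 * d <= d ^ 4\<close>; hence the 4 in
        \<open>B\<close>.\<close>
      have "\<mu> j \<le> 3 * (l * real d + l * real d)"
        using that l ln_d_le by (simp add: small_def)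
      then have "\<mu> j / l \<le> 6 * real d" using l(1) by (simp add: field_simps)
      also have "\<dots> \<le> real d ^ 4"
      proof -
        have "2 ^ 3 \<le> real d ^ 3" using assms by (intro power_mono) auto
        then have "6 * real d \<le> real d ^ 3 * real d" by (intro mult_right_mono) auto
        then show ?thesis by (simp add: numeral_eq_Suc mult.assoc)
      qed
      finally have "ln (\<mu> j / l) \<le> ln (real d ^ 4)"
        using divide_pos_pos[OF that(1), of l] l(1) assms by (intro ln_mono) auto
      then show "ln (\<mu> j / l) \<le> B" using assms by (simp add: ln_realpow B_def)
    qed
    note ln_le = this
    have "v j \<le> B \<and> v j \<le> \<mu> j"
    proof (cases "0 < \<mu> j \<and> small j")
      case True
      then show ?thesis
        using ln_le \<open>0 \<le> \<mu> j\<close> \<open>0 \<le> B\<close> by (simp only: v_def if_True max.bounded_iff)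
    next
      case False
      have "v j = 0"
      proof (cases "small j")
        case True
        then have "\<mu> j = 0" using False \<open>0 \<le> \<mu> j\<close> by linarith
        \<comment> \<open>The convention \<open>ln 0 = 0\<close> is used here.\<close>
        then have "ln (\<mu> j / l) = 0" by (simp only: div_0 ln_0)
        then show ?thesis by (simp only: v_def max.idem if_cancel)
      qed (simp only: v_def if_False)
      then show ?thesis using \<open>0 \<le> \<mu> j\<close> \<open>0 \<le> B\<close> by (simp only:)
    qed
    then show "v j \<le> B" "v j \<le> \<mu> j" by blast+
  qed
  let ?H = "\<lambda>\<omega>. \<Sum>j\<in>{1..d}. (sqrt (real (N j \<omega>)) - sqrt (\<mu> j))\<^sup>2"
  let ?T = "\<lambda>\<omega>. \<Sum>j\<in>{1..d}. \<mu> j * v j * of_bool (real (N j \<omega>) < \<mu> j / 4)"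
  let ?J = "{j\<in>{1..d}. \<not> small j}"
  define E1 where "E1 = {\<omega>\<in>space M. 10 * real d + 4 * L \<le> ?H \<omega>}"
  define E2 where "E2 = {\<omega>\<in>space M. \<exists>j\<in>?J. real (N j \<omega>) < \<mu> j / 4}"
  define E3 where "E3 = {\<omega>\<in>space M. 57 * real d + 16 / 3 * B * L \<le> ?T \<omega>}"
  have sets: "E1 \<in> events" "E2 \<in> events" "E3 \<in> events"
    unfolding E1_def E2_def E3_def by measurable
  have "prob E1 \<le> \<delta>"
    unfolding E1_def L_def using \<open>0 < \<delta>\<close> by (rule hellinger_tail)
  have "prob E2 \<le> \<delta>"
    unfolding E2_def
    by (rule lower_tail_large_means) (use \<open>0 < \<delta>\<close> assms(2) in \<open>auto simp: small_def L_def not_less\<close>)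
  have "0 < B" using ln_d by (simp add: B_def)
  then have "prob E3 \<le> \<delta>"
    unfolding E3_def L_def using \<open>0 < \<delta>\<close> v by (intro weighted_lower_tail)
  have "{\<omega>\<in>space M. ereal (110000 * ((real d + ln (real d) * ln (1 / \<delta>)) / real n))
      \<le> KL d p (estimator n d \<delta> (\<lambda>i. X i \<omega>))} \<subseteq> E1 \<union> E2 \<union> E3"
  proof (rule subsetI, rule ccontr)
    fix \<omega> assume "\<omega> \<in> {\<omega>\<in>space M. ereal (110000 * ((real d + ln (real d) * ln (1 / \<delta>)) / real n))
      \<le> KL d p (estimator n d \<delta> (\<lambda>i. X i \<omega>))}"
      and "\<omega> \<notin> E1 \<union> E2 \<union> E3"
    then have \<omega>: "\<omega> \<in> space M"
      and KL: "ereal (110000 * ((real d + ln (real d) * L) / real n))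
        \<le> KL d p (estimator n d \<delta> (\<lambda>i. X i \<omega>))"
      and E: "\<omega> \<notin> E1" "\<omega> \<notin> E2" "\<omega> \<notin> E3"
      unfolding L_def by blast+
    have H: "?H \<omega> < 10 * real d + 4 * L"
      using E(1) \<omega> unfolding E1_def by (simp only: mem_Collect_eq simp_thms not_le)
    have large: "\<mu> j / 4 \<le> real (N j \<omega>)" if "j \<in> {1..d}" "\<not> small j" for j
      using E(2) \<omega> that unfolding E2_def by (force simp only: mem_Collect_eq not_le)
    have T: "?T \<omega> < 57 * real d + 16 / 3 * B * L"
      using E(3) \<omega> unfolding E3_def by (simp only: mem_Collect_eq simp_thms not_le)
    let ?D = "\<Sum>j\<in>{1..d}. p j * ln (p j / ((real (N j \<omega>) + l) / (real n + l * real d)))"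
    have "KL d p (estimator n d \<delta> (\<lambda>i. X i \<omega>)) = ereal ?D"
      using l(1) by (subst KL_eq_sum) (auto simp: estimator_def l_def[symmetric] add_nonneg_pos)
    then have "110000 * (real d + ln (real d) * L) \<le> real n * ?D"
      using KL assms by (simp add: field_simps)
    also have "\<dots> \<le> (\<Sum>j\<in>{1..d}. \<mu> j * ln (\<mu> j / (real (N j \<omega>) + l)) - \<mu> j + (real (N j \<omega>) + l))"
      using assms l(1) sum_N[OF \<omega>] by (intro scaled_KL_smoothed_le) auto
    also have "\<dots> \<le> (\<Sum>j\<in>{1..d}. 18 * (sqrt (real (N j \<omega>)) - sqrt (\<mu> j))\<^sup>2 + 18 * l
        + \<mu> j * v j * of_bool (real (N j \<omega>) < \<mu> j / 4))"
    proof (rule sum_mono)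
      fix j assume j: "j \<in> {1..d}"
      \<comment> \<open>Off \<open>E2\<close> the indicator vanishes for large means, so the weight
        may be replaced by \<open>v j\<close>.\<close>
      have "\<mu> j * max 0 (ln (\<mu> j / l)) * of_bool (real (N j \<omega>) < \<mu> j / 4)
          = \<mu> j * v j * of_bool (real (N j \<omega>) < \<mu> j / 4)"
        using large[OF j] by (auto simp: v_def not_less)
      then show "\<mu> j * ln (\<mu> j / (real (N j \<omega>) + l)) - \<mu> j + (real (N j \<omega>) + l)
          \<le> 18 * (sqrt (real (N j \<omega>)) - sqrt (\<mu> j))\<^sup>2 + 18 * l
            + \<mu> j * v j * of_bool (real (N j \<omega>) < \<mu> j / 4)"
        using smoothed_relative_entropy_le[of "\<mu> j" l "N j \<omega>"] p_nonneg[OF j] l(1)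
        by (simp only: mult_nonneg_nonneg of_nat_0_le_iff)
    qed
    also have "\<dots> = 18 * ?H \<omega> + 18 * (l * real d) + ?T \<omega>"
      by (simp add: sum.distrib sum_distrib_left)
    also have "\<dots> < 18 * (10 * real d + 4 * L) + 18 * (real d + L) + (57 * real d + 16 / 3 * B * L)"
      using H T l(4) by simp
    \<comment> \<open>\<open>255 = 180 + 18 + 57\<close>, \<open>90 = 72 + 18\<close> and
      \<open>64 / 3 = 16 / 3 * 4\<close>.\<close>
    also have "\<dots> = 255 * real d + 90 * L + 64 / 3 * (ln (real d) * L)"
      by (simp add: B_def)
    also have "\<dots> \<le> 110000 * (real d + ln (real d) * L)"
    proof -
      define z where "z = ln (real d) * L"
      \<comment> \<open>\<open>ln d >= 1 / 2\<close> lets the term \<open>ln d * L\<close> absorb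
        the isolated multiples of \<open>L\<close>.\<close>
      have "1 / 2 * L \<le> z" using ln_d \<open>0 < L\<close> unfolding z_def by (intro mult_right_mono) auto
      then have "90 * L \<le> 180 * z" "0 \<le> z" using \<open>0 < L\<close> by auto
      then show ?thesis unfolding z_def[symmetric] by simp
    qed
    finally show False by simp
  qed
  then have "\<P>(\<omega> in M. KL d p (estimator n d \<delta> (\<lambda>i. X i \<omega>))
      \<ge> ereal (110000 * ((real d + ln (real d) * ln (1 / \<delta>)) / real n))) \<le> prob (E1 \<union> E2 \<union> E3)"
    using sets by (intro finite_measure_mono) auto
  also have "\<dots> \<le> prob E1 + prob E2 + prob E3"
    using measure_Un_le[of "E1 \<union> E2" M E3] measure_Un_le[of E1 M E2] sets by auto
  also have "\<dots> \<le> 4 * \<delta>"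
    using \<open>prob E1 \<le> \<delta>\<close> \<open>prob E2 \<le> \<delta>\<close> \<open>prob E3 \<le> \<delta>\<close> \<open>0 < \<delta>\<close> by simp
  finally show ?thesis .
qed

end
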